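(* Let $G$ be a connected graph of order $n\geq 3$ with $\Gamma_t(G)=k$, and let $X$ denote the set of stems of $G$. Then the $k$-total dominating graph $D_k^t(G)$ is connected if and only if $X$ is a total dominating set of $G$.
   Context: A total dominating set (TDS) of a graph $G$ without isolated vertices is a set $S\subseteq V(G)$ such that every vertex of $G$ is adjacent to a vertex of $S$. A minimal TDS (MTDS) is a TDS no proper subset of which is a TDS. $\Gamma_t(G)$ is the maximum cardinality of an MTDS. A leaf is a vertex of degree $1$ and a stem is a vertex adjacent to a leaf (in a graph not isomorphic to $K_2$). For a positive integer $k$, the $k$-total dominating graph $D_k^t(G)$ is the graph whose vertices are the TDSs of $G$ of cardinality at most $k$, two being adjacent if and only if one is obtained from the other by adding or deleting a single vertex. *)

theory Defs
  imports "Graph_Theory.Digraph_Component"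
begin

text \<open>
  A finite simple graph is a symmetric digraph without loops and parallel arcs (locale
  \<open>Digraph.graph\<close>); \<open>u \<rightarrow>\<^bsub>G\<^esub> v\<close> is adjacency. In such a graph each edge at \<open>v\<close> contributes
  exactly one outgoing arc, so the out-degree of \<open>v\<close> is its degree.
\<close>

definition total_dominating :: "('a, 'b) pre_digraph \<Rightarrow> 'a set \<Rightarrow> bool" where
  "total_dominating G S \<longleftrightarrow> S \<subseteq> verts G \<and> (\<forall>v \<in> verts G. \<exists>u \<in> S. v \<rightarrow>\<^bsub>G\<^esub> u)"

definition minimal_total_dominating :: "('a, 'b) pre_digraph \<Rightarrow> 'a set \<Rightarrow> bool" where
  "minimal_total_dominating G S \<longleftrightarrow>
     total_dominating G S \<and> (\<forall>T. T \<subset> S \<longrightarrow> \<not> total_dominating G T)"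

text \<open>
  The maximum is over a finite nonempty set whenever \<open>G\<close> is finite and has no isolated vertices
  (then \<open>verts G\<close> is total dominating); otherwise the value is not meaningful.
\<close>

definition upper_total_domination_number :: "('a, 'b) pre_digraph \<Rightarrow> nat" where
  "upper_total_domination_number G = Max (card ` {S. minimal_total_dominating G S})"

definition leaf :: "('a, 'b) pre_digraph \<Rightarrow> 'a \<Rightarrow> bool" where
  "leaf G v \<longleftrightarrow> v \<in> verts G \<and> out_degree G v = 1"

text \<open>Stems are only considered in graphs that are not isomorphic to \<open>K\<^sub>2\<close>.\<close>

definition stems :: "('a, 'b) pre_digraph \<Rightarrow> 'a set" where
  "stems G = {v \<in> verts G. \<exists>u. leaf G u \<and> v \<rightarrow>\<^bsub>G\<^esub> u}"

definition total_dominating_graph ::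
    "nat \<Rightarrow> ('a, 'b) pre_digraph \<Rightarrow> 'a set pair_pre_digraph" where
  "total_dominating_graph k G =
     (let \<V> = {S. total_dominating G S \<and> card S \<le> k} in
       \<lparr> pverts = \<V>,
         parcs = {(S, T). S \<in> \<V> \<and> T \<in> \<V> \<and>
           (\<exists>x. (x \<notin> S \<and> T = insert x S) \<or> (x \<in> S \<and> T = S - {x}))} \<rparr>)"

end

theory Submission
  imports Defs
begin

text \<open>
  A minimal total dominating set of maximum cardinality \<open>k\<close> is isolated in the graph of total
  dominating sets of size at most \<open>k\<close>: adding a vertex exceeds \<open>k\<close>, deleting one contradicts
  minimality. Every minimal total dominating set is a vertex of that graph, so connectivity means
  that there is only one. Stems lie in every total dominating set, and deleting a single non-stem
  from the vertex set leaves a total dominating set; hence the unique minimal one is the set of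
  stems.
\<close>

lemma total_dominating_contains_minimal:
  assumes "finite S" and "total_dominating G S"
  obtains T where "T \<subseteq> S" and "minimal_total_dominating G T"
proof -
  let ?P = "{T. T \<subseteq> S \<and> total_dominating G T}"
  have "finite ?P" using assms(1) by simp
  moreover have "S \<in> ?P" using assms(2) by simp
  ultimately obtain T where T: "T \<in> ?P" and min: "\<forall>U\<in>?P. U \<subseteq> T \<longrightarrow> T = U"
    by (metis (no_types, lifting) finite_has_minimal2)
  have "minimal_total_dominating G T"
    unfolding minimal_total_dominating_def
  proof (intro conjI allI impI notI)
    show "total_dominating G T" using T by simp
    fix U assume "U \<subset> T" and "total_dominating G U"
    with T have "U \<in> ?P" by auto
    with min \<open>U \<subset> T\<close> show False by auto
  qed
  then show thesis using T by (intro that) auto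
qed

text \<open>Without parallel arcs, \<open>head G\<close> is injective on the arcs leaving
  \<open>v\<close>, so the out-degree counts neighbours. Leaves can then be treated through
  adjacency alone.\<close>

lemma (in nomulti_digraph) out_degree_eq_1_iff:
  "out_degree G v = 1 \<longleftrightarrow> (\<exists>!u. v \<rightarrow>\<^bsub>G\<^esub> u)"
proof -
  have "inj_on (head G) (out_arcs G v)"
    by (rule inj_onI) (auto simp: out_arcs_def arc_to_ends_def intro: no_multi_arcs)
  moreover have "head G ` out_arcs G v = {u. v \<rightarrow>\<^bsub>G\<^esub> u}"
    by (auto simp: out_arcs_def arcs_ends_conv)
  ultimately have "out_degree G v = card {u. v \<rightarrow>\<^bsub>G\<^esub> u}"
    unfolding out_degree_def by (metis card_image)
  then show ?thesis
    by (simp add: card_1_singleton_iff set_eq_iff Ex1_def) blast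
qed

text \<open>The witness is the first step of a walk from \<open>u\<close> to the distinct vertex
  \<open>v\<close>.\<close>

lemma (in sym_digraph) connected_imp_adjacent:
  assumes "connected G" and "u \<in> verts G" and "v \<in> verts G" and "u \<noteq> v"
  obtains w where "u \<rightarrow>\<^bsub>G\<^esub> w"
proof -
  have "u \<rightarrow>\<^sup>*\<^bsub>G\<^esub> v"
    using symmetric_connected_imp_strongly_connected[OF sym_arcs assms(1)] assms(2,3)
    unfolding strongly_connected_def by blast
  then show thesis
    using assms(4) that by (cases rule: converse_reachable_cases) auto
qed

context graph
begin

lemma finite_total_dominating: "total_dominating G S \<Longrightarrow> finite S"
  unfolding total_dominating_def by (auto intro: finite_subset)

text \<open>A leaf has its stem as sole neighbour, so only the stem can dominate it.\<close>

lemma stems_subset_total_dominating: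
  assumes "total_dominating G S"
  shows "stems G \<subseteq> S"
proof
  fix v assume "v \<in> stems G"
  then obtain u where "leaf G u" and "v \<rightarrow>\<^bsub>G\<^esub> u"
    unfolding stems_def by blast
  moreover from this(2) have "u \<rightarrow>\<^bsub>G\<^esub> v"
    by (rule arcs_ends_symmetric[OF sym_arcs])
  ultimately show "v \<in> S"
    using assms unfolding leaf_def out_degree_eq_1_iff total_dominating_def by blast
qed

lemma total_dominating_verts:
  assumes "\<And>v. v \<in> verts G \<Longrightarrow> \<exists>u. v \<rightarrow>\<^bsub>G\<^esub> u"
  shows "total_dominating G (verts G)"
  using assms adj_in_verts(2) unfolding total_dominating_def by blast

text \<open>A vertex left undominated by the deletion would have \<open>v\<close> as its only
  neighbour; it would be a leaf, and \<open>v\<close> its stem.\<close>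

lemma total_dominating_delete_nonstem:
  assumes no_isolated: "\<And>v. v \<in> verts G \<Longrightarrow> \<exists>u. v \<rightarrow>\<^bsub>G\<^esub> u"
    and v: "v \<in> verts G" "v \<notin> stems G"
  shows "total_dominating G (verts G - {v})"
  unfolding total_dominating_def
proof (intro conjI ballI)
  fix w assume w: "w \<in> verts G"
  show "\<exists>u\<in>verts G - {v}. w \<rightarrow>\<^bsub>G\<^esub> u"
  proof (rule ccontr)
    assume "\<not> ?thesis"
    then have only: "u = v" if "w \<rightarrow>\<^bsub>G\<^esub> u" for u
      using that adj_in_verts(2) by blast
    with no_isolated[OF w] have wv: "w \<rightarrow>\<^bsub>G\<^esub> v" by metis
    then have "\<exists>!u. w \<rightarrow>\<^bsub>G\<^esub> u" using only by (rule ex1I)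
    then have "leaf G w" using w unfolding leaf_def out_degree_eq_1_iff by simp
    moreover have "v \<rightarrow>\<^bsub>G\<^esub> w"
      using wv by (rule arcs_ends_symmetric[OF sym_arcs])
    ultimately show False
      using v unfolding stems_def by blast
  qed
qed blast

lemma finite_minimal_total_dominating: "finite {S. minimal_total_dominating G S}"
  by (rule finite_subset[of _ "Pow (verts G)"])
     (auto simp: minimal_total_dominating_def total_dominating_def)

lemma minimal_total_dominating_card_le:
  assumes "minimal_total_dominating G S"
  shows "card S \<le> upper_total_domination_number G"
  using assms finite_minimal_total_dominating
  unfolding upper_total_domination_number_def by simp

text \<open>The hypothesis provides some minimal total dominating set, so the \<open>Max\<close>
  ranges over a nonempty finite set and is attained.\<close>

lemma maximum_minimal_total_dominating:
  assumes "total_dominating G S"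
  obtains M where "minimal_total_dominating G M" and "card M = upper_total_domination_number G"
proof -
  obtain T where "minimal_total_dominating G T"
    using total_dominating_contains_minimal[OF finite_total_dominating[OF assms] assms] .
  then have "card ` {S. minimal_total_dominating G S} \<noteq> {}" by auto
  then have "upper_total_domination_number G \<in> card ` {S. minimal_total_dominating G S}"
    unfolding upper_total_domination_number_def
    using finite_minimal_total_dominating by (intro Max_in) auto
  then show thesis using that by auto
qed

lemma minimal_total_dominating_stems_iff:
  assumes no_isolated: "\<And>v. v \<in> verts G \<Longrightarrow> \<exists>u. v \<rightarrow>\<^bsub>G\<^esub> u"
  shows "(\<exists>!S. minimal_total_dominating G S) \<longleftrightarrow> total_dominating G (stems G)"
proof
  assume "\<exists>!S. minimal_total_dominating G S"
  then obtain M where M: "minimal_total_dominating G M"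
    and uniq: "\<And>S. minimal_total_dominating G S \<Longrightarrow> S = M" by blast
  have td: "total_dominating G M" and sub: "M \<subseteq> verts G"
    using M unfolding minimal_total_dominating_def total_dominating_def by auto
  have "M \<subseteq> stems G"
  proof
    fix v assume "v \<in> M"
    show "v \<in> stems G"
    proof (rule ccontr)
      assume "v \<notin> stems G"
      \<comment> \<open>A minimal total dominating set inside \<open>verts G - {v}\<close> avoids
        \<open>v\<close>, hence differs from \<open>M\<close>, against uniqueness.\<close>
      then have "total_dominating G (verts G - {v})"
        using total_dominating_delete_nonstem no_isolated \<open>v \<in> M\<close> sub by blast
      then obtain T where "T \<subseteq> verts G - {v}" "minimal_total_dominating G T"
        using total_dominating_contains_minimal[of "verts G - {v}"] by auto
      with uniq \<open>v \<in> M\<close> show False by blast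
    qed
  qed
  with stems_subset_total_dominating[OF td] td show "total_dominating G (stems G)"
    by (metis subset_antisym)
next
  assume td: "total_dominating G (stems G)"
  show "\<exists>!S. minimal_total_dominating G S"
  proof (rule ex1I)
    \<comment> \<open>Every total dominating set contains the stems, so none is a proper subset of
      them.\<close>
    show "minimal_total_dominating G (stems G)"
      using td stems_subset_total_dominating unfolding minimal_total_dominating_def by auto
    fix S assume S: "minimal_total_dominating G S"
    then have "stems G \<subseteq> S"
      using stems_subset_total_dominating unfolding minimal_total_dominating_def by simp
    with S td show "S = stems G" unfolding minimal_total_dominating_def by auto
  qed
qed

text \<open>Both directions are excluded because connectedness is later read off the symmetric
  closure of the arcs.\<close>

lemma maximum_minimal_isolated:
  assumes M: "minimal_total_dominating G M" and "card M = k"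
  shows "(M, T) \<notin> parcs (total_dominating_graph k G)"
    and "(T, M) \<notin> parcs (total_dominating_graph k G)"
proof -
  have "finite M"
    using M finite_total_dominating unfolding minimal_total_dominating_def by simp
  have big: "\<not> card T \<le> k" if "x \<notin> M" and "T = insert x M" for x T
    using \<open>finite M\<close> \<open>card M = k\<close> that by simp
  have small: "\<not> total_dominating G T" if "x \<in> M" and "T = M - {x}" for x T
    using M that unfolding minimal_total_dominating_def by blast
  show "(M, T) \<notin> parcs (total_dominating_graph k G)"
    using big small by (auto simp: total_dominating_graph_def Let_def)
  show "(T, M) \<notin> parcs (total_dominating_graph k G)"
  proof
    assume "(T, M) \<in> parcs (total_dominating_graph k G)"
    then obtain x where T: "total_dominating G T" "card T \<le> k"
      and x: "x \<notin> T \<and> M = insert x T \<or> x \<in> T \<and> M = T - {x}"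
      by (auto simp: total_dominating_graph_def Let_def)
    \<comment> \<open>The same move seen from \<open>M\<close>: inserting into \<open>T\<close> is
      deleting from \<open>M\<close>, and conversely.\<close>
    from x have "x \<in> M \<and> T = M - {x} \<or> x \<notin> M \<and> T = insert x M" by blast
    with T big small show False by blast
  qed
qed

text \<open>An isolated vertex of a connected graph is its only vertex, and a graph with one vertex
  is connected. The hypothesis ensures that an isolated vertex, a largest minimal set,
  exists.\<close>

lemma connected_total_dominating_graph_iff:
  assumes "total_dominating G S"
  shows "connected (with_proj (total_dominating_graph (upper_total_domination_number G) G)) \<longleftrightarrow>
    (\<exists>M. {S. total_dominating G S \<and> card S \<le> upper_total_domination_number G} = {M})"
    (is "connected (with_proj ?D) \<longleftrightarrow> (\<exists>M. ?V = {M})")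
proof
  have V: "pverts ?D = ?V" by (simp add: total_dominating_graph_def Let_def)
  obtain M where M: "minimal_total_dominating G M" "card M = upper_total_domination_number G"
    using maximum_minimal_total_dominating[OF assms] .
  then have "M \<in> ?V" unfolding minimal_total_dominating_def by simp
  {
    assume conn: "connected (with_proj ?D)"
    have "T = M" if "T \<in> ?V" for T
    proof -
      have "(M, T) \<in> rtrancl_on ?V ((parcs ?D)\<^sup>s)"
        using conn that \<open>M \<in> ?V\<close> V unfolding connected_conv by simp
      then show ?thesis
        \<comment> \<open>Induction along the walk: it starts at \<open>M\<close> and can never
          leave it, as no arc in either direction touches \<open>M\<close>.\<close>
        by (induction rule: rtrancl_on_induct)
           (use maximum_minimal_isolated[OF M] in \<open>auto simp: symcl_def\<close>)
    qed
    with \<open>M \<in> ?V\<close> show "\<exists>M. ?V = {M}" by blast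
  next
    assume "\<exists>M. ?V = {M}"
    with V obtain N where "pverts ?D = {N}" by auto
    then show "connected (with_proj ?D)"
      unfolding connected_conv by simp
  }
qed

text \<open>Minimal sets all meet the size bound, which gives one direction. For the other, any set
  within the bound contains a minimal one, hence the unique \<open>M\<close>; as \<open>M\<close>
  already has the maximal permitted size, the two coincide.\<close>

lemma unique_small_iff_unique_minimal:
  assumes td: "total_dominating G S"
  shows "(\<exists>M. {S. total_dominating G S \<and> card S \<le> upper_total_domination_number G} = {M}) \<longleftrightarrow>
    (\<exists>!S. minimal_total_dominating G S)"
    (is "(\<exists>M. ?V = {M}) \<longleftrightarrow> _")
proof
  have min: "S \<in> ?V" if "minimal_total_dominating G S" for S
    using that minimal_total_dominating_card_le unfolding minimal_total_dominating_def by simp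
  obtain M where M: "minimal_total_dominating G M" "card M = upper_total_domination_number G"
    using maximum_minimal_total_dominating[OF td] .
  {
    assume "\<exists>M. ?V = {M}"
    with M min show "\<exists>!S. minimal_total_dominating G S" by blast
  next
    assume uniq: "\<exists>!S. minimal_total_dominating G S"
    have "T = M" if T: "T \<in> ?V" for T
    proof -
      have fin: "finite T"
        using T finite_total_dominating by simp
      then obtain U where "U \<subseteq> T" "minimal_total_dominating G U"
        using T total_dominating_contains_minimal by blast
      then have "M \<subseteq> T" using uniq M by blast
      with fin T M(2) show ?thesis by (metis (mono_tags, lifting) card_seteq mem_Collect_eq)
    qed
    with min[OF M(1)] show "\<exists>M. ?V = {M}" by blast
  }
qed

end

theorem theorem2p2:
  fixes G :: "('a, 'b) pre_digraph" and n k :: nat and X :: "'a set"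
  assumes "Digraph.graph G"
    and "Digraph_Component.connected G"
    and "card (verts G) = n" and "n \<ge> 3"
    and "upper_total_domination_number G = k"
    and "X = stems G"
  shows "Digraph_Component.connected (with_proj (total_dominating_graph k G)) \<longleftrightarrow>
    total_dominating G X"
proof -
  interpret graph G by fact
  have no_isolated: "\<exists>u. v \<rightarrow>\<^bsub>G\<^esub> u" if "v \<in> verts G" for v
  proof -
    \<comment> \<open>Otherwise the order would be at most 1. A second vertex \<open>w\<close> makes
      a walk leave \<open>v\<close>, so \<open>v\<close> has a neighbour.\<close>
    have "\<not> verts G \<subseteq> {v}"
      using assms(3,4) card_mono[of "{v}" "verts G"] by auto
    then obtain w where "w \<in> verts G" "v \<noteq> w" by blast
    then show ?thesis
      using connected_imp_adjacent[OF assms(2) that] by metis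
  qed
  have td: "total_dominating G (verts G)"
    using total_dominating_verts no_isolated by blast
  have "(\<exists>!S. minimal_total_dominating G S) \<longleftrightarrow> total_dominating G (stems G)"
    using no_isolated by (rule minimal_total_dominating_stems_iff)
  then show ?thesis
    using connected_total_dominating_graph_iff[OF td] unique_small_iff_unique_minimal[OF td]
      assms(5,6) by simp
qed

end
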